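(* Let ${\rm D}$ be an atomic integral domain with set of units ${\rm U}$. (1) Assume there is an integer $n_0\ge 2$ such that (a) for every $u\in{\rm U}$ there is $v\in{\rm D}$ with $v^{n_0}=u$, and (b) $\mathrm{FLT}_{n_0}$ holds in ${\rm D}$. Then ${\rm D}$ has an infinite number of irreducibles (up to units). (2) Assume there is an integer $n_0\ge 2$ such that (a) for every $u\in{\rm U}$, $u^{n_0}=u$, and (b) $\mathrm{FLT}_{n_0}$ holds in ${\rm D}$. Then ${\rm D}$ has an infinite number of irreducibles (up to units).
   Context: For $a\in\mathbb{N}$ and a domain ${\rm D}$, "$\mathrm{FLT}_a$ holds in ${\rm D}$" means the equation $x^a+y^a=z^a$ has no solution with $x,y,z\in{\rm D}-\{0\}$. A unit is an element with a multiplicative inverse in ${\rm D}$. An irreducible is a non-unit $p$ such that whenever $p=ab$, $a$ or $b$ is a unit. Two irreducibles $p,q$ are equivalent if $p=uq$ for some unit $u$; "infinite number of irreducibles (up to units)" means infinitely many equivalence classes. ${\rm D}$ is atomic if every nonzero non-unit element can be written (not necessarily uniquely) as a product $p_1^{x_1}\cdots p_m^{x_m}$ of irreducibles.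
   Formalization: The domain D is additionally assumed not to be the two-element field, which is atomic, satisfies (a) and (b) of both parts for every exponent, and yet has no irreducibles. *)

theory Defs
  imports "HOL-Computational_Algebra.Factorial_Ring"
begin

definition FLT_holds :: "'a::idom itself \<Rightarrow> nat \<Rightarrow> bool" where
  "FLT_holds D a \<longleftrightarrow>
     \<not> (\<exists>x y z :: 'a. x \<noteq> 0 \<and> y \<noteq> 0 \<and> z \<noteq> 0 \<and> x ^ a + y ^ a = z ^ a)"

definition atomic_domain :: "'a::idom itself \<Rightarrow> bool" where
  "atomic_domain D \<longleftrightarrow>
     (\<forall>x :: 'a. x \<noteq> 0 \<longrightarrow> \<not> x dvd 1 \<longrightarrow>
        (\<exists>(P :: 'a set) (e :: 'a \<Rightarrow> nat).
           finite P \<and> (\<forall>p\<in>P. irreducible p) \<and> x = (\<Prod>p\<in>P. p ^ e p)))"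

definition irreducible_equiv :: "('a::idom \<times> 'a) set" where
  "irreducible_equiv =
     {(p, q). irreducible p \<and> irreducible q \<and> (\<exists>u. u dvd 1 \<and> p = u * q)}"

lemma equiv_irreducible_equiv:
  "equiv {p :: 'a::idom. irreducible p} irreducible_equiv"
proof (rule equivI)
  show "irreducible_equiv \<subseteq> {p :: 'a. irreducible p} \<times> {p. irreducible p}"
    by (auto simp: irreducible_equiv_def)
  show "refl_on {p :: 'a. irreducible p} irreducible_equiv"
    by (auto simp: refl_on_def irreducible_equiv_def intro!: exI[of _ 1])
  show "sym (irreducible_equiv :: ('a \<times> 'a) set)"
  proof (rule symI)
    fix p q :: 'a
    assume "(p, q) \<in> irreducible_equiv"
    then obtain u where u: "irreducible p" "irreducible q" "u dvd 1" "p = u * q"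
      by (auto simp: irreducible_equiv_def)
    from u(3) obtain v where v: "1 = u * v" by (rule dvdE)
    have "q = v * p" using u(4) v by (metis mult.assoc mult.commute mult_1)
    moreover have "v dvd 1" using v by (metis dvd_triv_right)
    ultimately show "(q, p) \<in> irreducible_equiv"
      using u by (auto simp: irreducible_equiv_def)
  qed
  show "trans (irreducible_equiv :: ('a \<times> 'a) set)"
  proof (rule transI)
    fix p q r :: 'a
    assume "(p, q) \<in> irreducible_equiv" "(q, r) \<in> irreducible_equiv"
    then obtain u v where "irreducible p" "irreducible r" "u dvd 1" "v dvd 1"
      "p = (u * v) * r"
      by (auto simp: irreducible_equiv_def mult.assoc)
    moreover from this have "(u * v) dvd 1" by (metis mult_dvd_mono mult_1)
    ultimately show "(p, r) \<in> irreducible_equiv"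
      unfolding irreducible_equiv_def by blast
  qed
qed

definition infinitely_many_irreducibles :: "'a::idom itself \<Rightarrow> bool" where
  "infinitely_many_irreducibles D \<longleftrightarrow>
     infinite ({p :: 'a. irreducible p} // irreducible_equiv)"

text \<open>
  The two-element field satisfies every hypothesis of both parts, for every exponent,
  but has no irreducibles at all; it therefore has to be excluded.
\<close>

lemma two_element_field_counterexample:
  assumes "(UNIV :: 'a::idom set) = {0, 1}"
  shows "atomic_domain TYPE('a)"
    and "FLT_holds TYPE('a) n"
    and "(u :: 'a) dvd 1 \<Longrightarrow> u ^ n = u"
    and "\<not> infinitely_many_irreducibles TYPE('a)"
proof -
  have *: "x = 0 \<or> x = 1" for x :: 'a
    using assms by blast
  have "1 + 1 \<noteq> (1 :: 'a)"
    by (metis add_cancel_right_right zero_neq_one)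
  show "atomic_domain TYPE('a)"
    unfolding atomic_domain_def using * by (metis dvd_refl)
  show "FLT_holds TYPE('a) n"
    using * \<open>1 + 1 \<noteq> (1 :: 'a)\<close> unfolding FLT_holds_def by (metis power_one)
  show "u ^ n = u" if "(u :: 'a) dvd 1"
    using *[of u] that by auto
  have "{p :: 'a. irreducible p} = {}"
    using * by (metis (mono_tags, lifting) empty_Collect_eq not_irreducible_one not_irreducible_zero)
  then show "\<not> infinitely_many_irreducibles TYPE('a)"
    by (simp add: infinitely_many_irreducibles_def)
qed

end

theory Submission
  imports Defs "HOL-Library.Ramsey"
begin

text \<open>
  Suppose there are only finitely many irreducibles up to units. If every unit is an \<open>n\<close>-th power,
  then reducing exponents modulo \<open>n\<close> puts every nonzero element into one of finitely many classes
  \<open>g w\<^sup>n\<close>. For a sequence \<open>s\<close> of distinct elements, colour a pair \<open>i < j\<close> by the class of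
  \<open>s j - s i\<close>. Ramsey's theorem gives \<open>i < j < k\<close> for which all three differences lie in the same
  class, and cancelling \<open>g\<close> from \<open>(s j - s i) + (s k - s j) = s k - s i\<close> contradicts FLT. This works
  in any infinite domain, of whatever characteristic. A finite domain is a field, in which
  \<open>1 + (w - 1) = w\<close> contradicts FLT as soon as there is an element \<open>w\<close> other than 0 and 1.
  The second part is the case of the first in which a unit is its own \<open>n\<close>-th root.
\<close>

lemma finite_irreducible_representatives:
  assumes "\<not> infinitely_many_irreducibles TYPE('a::idom)"
  obtains R :: "'a::idom set" where "finite R"
    and "\<And>p. irreducible p \<Longrightarrow> \<exists>u. \<exists>r\<in>R. u dvd 1 \<and> p = u * r"
proof
  let ?Q = "{p :: 'a. irreducible p} // irreducible_equiv"
  show "finite ((\<lambda>C. SOME r. r \<in> C) ` ?Q)"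
    using assms by (simp add: infinitely_many_irreducibles_def)
  fix p :: 'a
  assume p: "irreducible p"
  define C where "C = irreducible_equiv `` {p}"
  define r where "r = (SOME r. r \<in> C)"
  have "C \<in> ?Q"
    using p by (simp add: C_def quotientI)
  then have "r \<in> (\<lambda>C. SOME r. r \<in> C) ` ?Q"
    unfolding r_def by (rule imageI)
  moreover have "p \<in> C"
    using p equiv_class_self[OF equiv_irreducible_equiv, of p] by (simp add: C_def)
  then have "r \<in> C"
    unfolding r_def by (rule someI)
  then have "\<exists>u. u dvd 1 \<and> p = u * r"
    by (simp add: C_def irreducible_equiv_def)
  ultimately show "\<exists>u. \<exists>r\<in>(\<lambda>C. SOME r. r \<in> C) ` ?Q. u dvd 1 \<and> p = u * r"
    by blast
qed

lemma finite_classes_modulo_powers: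
  assumes "atomic_domain TYPE('a::idom)"
    and "\<not> infinitely_many_irreducibles TYPE('a::idom)"
    and roots: "\<And>u :: 'a::idom. u dvd 1 \<Longrightarrow> \<exists>v. v ^ n = u"
    and "n > 0"
  obtains G :: "'a::idom set" where "finite G"
    and "\<And>x. x \<noteq> 0 \<Longrightarrow> \<exists>g\<in>G. \<exists>w. x = g * w ^ n"
proof -
  obtain R :: "'a set" where "finite R"
    and R: "\<And>p. irreducible p \<Longrightarrow> \<exists>u. \<exists>r\<in>R. u dvd 1 \<and> p = u * r"
    using finite_irreducible_representatives assms(2) by blast
  \<comment> \<open>The set \<open>S\<close> is closed under products and contains \<open>R\<close>
    as well as the units, which are \<open>n\<close>-th powers. Hence it contains every irreducible,
    a unit times an element of \<open>R\<close>, and by atomicity every nonzero element.\<close>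
  define S where "S = {x. \<exists>e w. x = (\<Prod>r\<in>R. r ^ e r) * w ^ n}"
  have S_mult: "x * y \<in> S" if x: "x \<in> S" and y: "y \<in> S" for x y
  proof -
    obtain e w f v where
      "x = (\<Prod>r\<in>R. r ^ e r) * w ^ n" "y = (\<Prod>r\<in>R. r ^ f r) * v ^ n"
      using x y unfolding S_def by blast
    then have "x * y = (\<Prod>r\<in>R. r ^ (e r + f r)) * (w * v) ^ n"
      by (simp add: power_add prod.distrib power_mult_distrib mult_ac)
    then show ?thesis
      unfolding S_def by (intro CollectI exI[of _ "\<lambda>r. e r + f r"] exI[of _ "w * v"])
  qed
  have S_unit: "u \<in> S" if u: "u dvd 1" for u
  proof -
    obtain v where "v ^ n = u"
      using roots[OF u] by blast
    then show ?thesis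
      unfolding S_def by (intro CollectI exI[of _ "\<lambda>_. 0"] exI[of _ v]) simp
  qed
  have S_R: "q \<in> S" if q: "q \<in> R" for q
  proof -
    have "(\<Prod>r\<in>R. r ^ (if r = q then 1 else 0)) = (\<Prod>r\<in>R. if r = q then r else 1)"
      by (intro prod.cong) auto
    also have "\<dots> = q"
      using \<open>finite R\<close> q by simp
    finally show ?thesis
      unfolding S_def by (intro CollectI exI[of _ "\<lambda>r. if r = q then 1 else 0"] exI[of _ 1]) simp
  qed
  have S_irreducible: "p \<in> S" if "irreducible p" for p
    using R[OF that] S_mult S_unit S_R by blast
  have S_power: "p ^ k \<in> S" if "p \<in> S" for p and k :: nat
    by (induction k) (use that S_mult S_unit in auto)
  have S_prod: "(\<Prod>p\<in>P. f p) \<in> S" if "finite P" "\<And>p. p \<in> P \<Longrightarrow> f p \<in> S" for P :: "'a set" and f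
    using that by (induction P rule: finite_induct) (auto intro: S_mult S_unit)
  have S_nonzero: "x \<in> S" if x: "x \<noteq> 0" for x
  proof (cases "x dvd 1")
    case True
    then show ?thesis by (rule S_unit)
  next
    case False
    then obtain P :: "'a set" and e :: "'a \<Rightarrow> nat" where
      "finite P" "\<forall>p\<in>P. irreducible p" "x = (\<Prod>p\<in>P. p ^ e p)"
      using assms(1) x unfolding atomic_domain_def by blast
    then show ?thesis
      using S_prod S_power S_irreducible by simp
  qed
  show thesis
  proof
    \<comment> \<open>Coefficients with exponents below \<open>n\<close> will suffice; as
      \<open>R\<close> is finite, there are only finitely many extensional exponent
      functions.\<close>
    show "finite ((\<lambda>e. \<Prod>r\<in>R. r ^ e r) ` (R \<rightarrow>\<^sub>E {..<n}))"
      using \<open>finite R\<close> by (intro finite_imageI finite_PiE) auto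
    fix x :: 'a
    assume "x \<noteq> 0"
    then obtain e w where x: "x = (\<Prod>r\<in>R. r ^ e r) * w ^ n"
      using S_nonzero unfolding S_def by blast
    let ?c = "restrict (\<lambda>r. e r mod n) R"
    have "(\<Prod>r\<in>R. r ^ e r) = (\<Prod>r\<in>R. r ^ ?c r * (r ^ (e r div n)) ^ n)"
      by (intro prod.cong) (simp_all flip: power_mult power_add)
    then have "x = (\<Prod>r\<in>R. r ^ ?c r) * ((\<Prod>r\<in>R. r ^ (e r div n)) * w) ^ n"
      using x by (simp add: prod.distrib prod_power_distrib power_mult_distrib mult_ac)
    moreover have "?c \<in> R \<rightarrow>\<^sub>E {..<n}"
      using \<open>n > 0\<close> by auto
    ultimately show "\<exists>g\<in>(\<lambda>e. \<Prod>r\<in>R. r ^ e r) ` (R \<rightarrow>\<^sub>E {..<n}). \<exists>w. x = g * w ^ n"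
      by blast
  qed
qed

text \<open>A form of Schur's theorem: the differences along a monochromatic triangle
  telescope.\<close>

lemma monochromatic_sum_in_infinite_group:
  fixes c :: "'a::ab_group_add \<Rightarrow> 'b"
  assumes "infinite (UNIV :: 'a::ab_group_add set)" and "finite (c ` (- {0}))"
  obtains x y where "x \<noteq> 0" "y \<noteq> 0" "x + y \<noteq> 0" "c x = c y" "c (x + y) = c y"
proof -
  obtain s :: "nat \<Rightarrow> 'a" where s: "inj s"
    using assms(1) infinite_countable_subset by blast
  \<comment> \<open>\<open>Ramsey2\<close> takes its colours from an initial segment of the
    naturals, so \<open>h\<close> numbers the values of \<open>c\<close>; its injectivity later
    carries equality back to \<open>c\<close>.\<close>
  obtain h :: "'b \<Rightarrow> nat" and m where h: "h ` c ` (- {0}) = {i. i < m}" "inj_on h (c ` (- {0}))"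
    using finite_imp_inj_to_nat_seg[OF assms(2)] by metis
  \<comment> \<open>Ramsey colours unordered pairs, whereas \<open>c\<close> may differ at
    \<open>x\<close> and \<open>- x\<close>; \<open>Max\<close> and \<open>Min\<close> fix the
    orientation.\<close>
  define f where "f X = h (c (s (Max X) - s (Min X)))" for X
  have distinct: "s j - s i \<noteq> 0" if "i < j" for i j
    using that injD[OF s] by fastforce
  have f_eq: "f {i, j} = h (c (s j - s i))" if "i < j" for i j
    using that by (simp add: f_def max_def min_def)
  have f_less: "f {i, j} < m" if "i < j" for i j
    using f_eq[OF that] distinct[OF that] h(1) by (metis ComplI imageI mem_Collect_eq singletonD)
  have "f {i, j} < m" if "i \<noteq> j" for i j
    using f_less[of i j] f_less[of j i] that by (metis insert_commute linorder_neqE_nat)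
  then obtain Y t where Y: "infinite Y" "\<forall>i\<in>Y. \<forall>j\<in>Y. i \<noteq> j \<longrightarrow> f {i, j} = t"
    using Ramsey2[of "UNIV :: nat set" f m] by auto
  obtain i where i: "i \<in> Y"
    using Y(1) by (metis finite.emptyI all_not_in_conv)
  obtain j where j: "j \<in> Y" "i < j"
    using Y(1) infinite_nat_iff_unbounded by blast
  obtain k where k: "k \<in> Y" "j < k"
    using Y(1) infinite_nat_iff_unbounded by blast
  have colour: "h (c (s b - s a)) = t" if "a \<in> Y" "b \<in> Y" "a < b" for a b
    using Y(2) f_eq[of a b] that by simp
  let ?x = "s j - s i" and ?y = "s k - s j"
  have sum: "?x + ?y = s k - s i"
    by simp
  have nz: "?x \<noteq> 0" "?y \<noteq> 0" "?x + ?y \<noteq> 0"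
    unfolding sum using distinct j(2) k(2) by (metis less_trans)+
  have "h (c ?x) = t" "h (c ?y) = t" "h (c (?x + ?y)) = t"
    unfolding sum using colour i j k by (metis less_trans)+
  then have "c ?x = c ?y" "c (?x + ?y) = c ?y"
    using nz by (auto intro!: inj_onD[OF h(2)] simp del: diff_add_cancel)
  then show thesis
    using that nz by blast
qed

lemma finite_idom_dvd_one:
  fixes x :: "'a::idom"
  assumes "finite (UNIV :: 'a set)" and "x \<noteq> 0"
  shows "x dvd 1"
proof -
  have "inj ((*) x)"
    using assms(2) by (simp add: inj_on_def)
  then have "surj ((*) x)"
    by (rule finite_UNIV_inj_surj[OF assms(1)])
  then show ?thesis
    by (metis dvd_def surjD)
qed

lemma infinitely_many_irreducibles_of_unit_roots:
  assumes "atomic_domain TYPE('a::idom)"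
    and "(UNIV :: 'a set) \<noteq> {0, 1}"
    and "n > 0"
    and roots: "\<And>u :: 'a. u dvd 1 \<Longrightarrow> \<exists>v. v ^ n = u"
    and FLT: "FLT_holds TYPE('a) n"
  shows "infinitely_many_irreducibles TYPE('a)"
proof (rule ccontr)
  assume "\<not> infinitely_many_irreducibles TYPE('a)"
  then obtain G :: "'a set" where "finite G"
    and G: "\<And>x. x \<noteq> 0 \<Longrightarrow> \<exists>g\<in>G. \<exists>w. x = g * w ^ n"
    using finite_classes_modulo_powers assms(1,3) roots by blast
  show False
  proof (cases "finite (UNIV :: 'a set)")
    case True
    obtain w :: 'a where w: "w \<noteq> 0" "w \<noteq> 1"
      using assms(2) by blast
    \<comment> \<open>The root is nonzero because \<open>0 ^ n = 0\<close> for
      \<open>n > 0\<close>.\<close>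
    have nth_root: "\<exists>v. v \<noteq> 0 \<and> v ^ n = x" if "x \<noteq> 0" for x :: 'a
      using roots[OF finite_idom_dvd_one[OF True that]] that \<open>n > 0\<close> by (metis zero_power)
    have "w - 1 \<noteq> 0"
      using w by simp
    then obtain a b where "a \<noteq> 0" "a ^ n = w - 1" "b \<noteq> 0" "b ^ n = w"
      using nth_root w(1) by metis
    then have "1 ^ n + a ^ n = b ^ n"
      by simp
    then show False
      using FLT \<open>a \<noteq> 0\<close> \<open>b \<noteq> 0\<close> unfolding FLT_holds_def by (metis one_neq_zero)
  next
    case False
    \<comment> \<open>The colour of \<open>x\<close> is a coefficient from \<open>G\<close>, so
      equal colours give a common factor to cancel.\<close>
    obtain c where c: "\<And>x. x \<noteq> 0 \<Longrightarrow> c x \<in> G \<and> (\<exists>w. x = c x * w ^ n)"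
      using G by metis
    have "finite (c ` (- {0}))"
      using c by (intro finite_subset[OF _ \<open>finite G\<close>]) auto
    then obtain x y where xy: "x \<noteq> 0" "y \<noteq> 0" "x + y \<noteq> 0" "c x = c y" "c (x + y) = c y"
      using monochromatic_sum_in_infinite_group[OF False] by blast
    obtain u v w where eqs: "x = c y * u ^ n" "y = c y * v ^ n" "x + y = c y * w ^ n"
      using c xy by metis
    then have "c y * (u ^ n + v ^ n) = c y * w ^ n"
      by (simp add: distrib_left)
    \<comment> \<open>If one of these vanished, so would \<open>x\<close>, \<open>y\<close> or
      \<open>x + y\<close>, again by \<open>n > 0\<close>.\<close>
    moreover have nz: "c y \<noteq> 0" "u \<noteq> 0" "v \<noteq> 0" "w \<noteq> 0"
      using eqs xy(1-3) \<open>n > 0\<close> by (metis mult_zero_left mult_zero_right zero_power)+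
    ultimately have "u ^ n + v ^ n = w ^ n"
      by simp
    then show False
      using FLT nz unfolding FLT_holds_def by blast
  qed
qed

theorem theorem3p2:
  assumes "atomic_domain TYPE('a::idom)"
    and "(UNIV :: 'a set) \<noteq> {0, 1}"
  shows "((\<exists>n0 :: nat. n0 \<ge> 2 \<and>
             (\<forall>u :: 'a. u dvd 1 \<longrightarrow> (\<exists>v :: 'a. v ^ n0 = u)) \<and>
             FLT_holds TYPE('a) n0)
          \<longrightarrow> infinitely_many_irreducibles TYPE('a)) \<and>
         ((\<exists>n0 :: nat. n0 \<ge> 2 \<and>
             (\<forall>u :: 'a. u dvd 1 \<longrightarrow> u ^ n0 = u) \<and>
             FLT_holds TYPE('a) n0)
          \<longrightarrow> infinitely_many_irreducibles TYPE('a))"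
proof (intro conjI impI; elim exE conjE)
  fix n :: nat
  assume "n \<ge> 2" "\<forall>u :: 'a. u dvd 1 \<longrightarrow> (\<exists>v. v ^ n = u)" "FLT_holds TYPE('a) n"
  then show "infinitely_many_irreducibles TYPE('a)"
    using infinitely_many_irreducibles_of_unit_roots[OF assms, of n] by simp
next
  fix n :: nat
  assume "n \<ge> 2" "\<forall>u :: 'a. u dvd 1 \<longrightarrow> u ^ n = u" "FLT_holds TYPE('a) n"
  then show "infinitely_many_irreducibles TYPE('a)"
    using infinitely_many_irreducibles_of_unit_roots[OF assms, of n] by fastforce
qed

end
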